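(* Let $d \ge 3$ and let $S$ be an orthocentric $d$-simplex in $\mathbb{E}^d$ with centroid $G$, circumcenter $C$, incenter $I$ and orthocenter $H$. Then the following conditions are equivalent: (1) $S$ is regular; (2) $S$ is equifacetal; (3) $G = C = I = H$; (4) some two of the four centers $G, C, I, H$ coincide.
   Context: $\mathbb{E}^d$ is $d$-dimensional Euclidean space. A $d$-simplex $S=[A_1,\dots,A_{d+1}]$ is the convex hull of $d+1$ affinely independent points. Its facets are its $(d-1)$-faces. The altitude from $A_i$ is the line through $A_i$ perpendicular to the hyperplane spanned by the facet opposite to $A_i$. $S$ is orthocentric if its $d+1$ altitudes have a common point, called the orthocenter $H$. The centroid $G$ is the average of the vertices; the circumcenter $C$ is the center of the unique sphere containing all vertices; the incenter $I$ is the center of the inscribed sphere, i.e. the sphere contained in $S$ touching all facets. $S$ is regular if all its edges have the same length, and equifacetal if all its facets are congruent. *)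

theory Defs
  imports "HOL-Analysis.Analysis"
begin

definition vertices :: "'a::euclidean_space set \<Rightarrow> 'a set" where
  "vertices S = {v. v extreme_point_of S}"

definition opposite_facet :: "'a::euclidean_space set \<Rightarrow> 'a \<Rightarrow> 'a set" where
  "opposite_facet S v = convex hull (vertices S - {v})"

(* For a full-dimensional simplex the affine hull of a facet is a hyperplane,
   so the points satisfying this condition form a line. *)
definition altitude :: "'a::euclidean_space set \<Rightarrow> 'a \<Rightarrow> 'a set" where
  "altitude S v =
     {x. \<forall>p \<in> affine hull (opposite_facet S v). \<forall>q \<in> affine hull (opposite_facet S v).
           orthogonal (x - v) (p - q)}"

definition is_orthocenter :: "'a::euclidean_space set \<Rightarrow> 'a \<Rightarrow> bool" where
  "is_orthocenter S H \<longleftrightarrow> (\<forall>v \<in> vertices S. H \<in> altitude S v)"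

definition orthocentric :: "'a::euclidean_space set \<Rightarrow> bool" where
  "orthocentric S \<longleftrightarrow> (\<exists>H. is_orthocenter S H)"

definition is_centroid :: "'a::euclidean_space set \<Rightarrow> 'a \<Rightarrow> bool" where
  "is_centroid S G \<longleftrightarrow> G = (1 / real (card (vertices S))) *\<^sub>R (\<Sum>v\<in>vertices S. v)"

definition is_circumcenter :: "'a::euclidean_space set \<Rightarrow> 'a \<Rightarrow> bool" where
  "is_circumcenter S C \<longleftrightarrow> (\<exists>r. vertices S \<subseteq> sphere C r)"

definition is_incenter :: "'a::euclidean_space set \<Rightarrow> 'a \<Rightarrow> bool" where
  "is_incenter S I \<longleftrightarrow>
     (\<exists>r>0. sphere I r \<subseteq> S \<and> (\<forall>F. F facet_of S \<longrightarrow> sphere I r \<inter> F \<noteq> {}))"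

(* Edges are the segments joining two distinct vertices. *)
definition regular_simplex :: "'a::euclidean_space set \<Rightarrow> bool" where
  "regular_simplex S \<longleftrightarrow>
     (\<exists>l. \<forall>v \<in> vertices S. \<forall>w \<in> vertices S. v \<noteq> w \<longrightarrow> dist v w = l)"

definition congruent_sets :: "'a::euclidean_space set \<Rightarrow> 'a set \<Rightarrow> bool" where
  "congruent_sets X Y \<longleftrightarrow>
     (\<exists>f :: 'a \<Rightarrow> 'a. (\<forall>x y. dist (f x) (f y) = dist x y) \<and> f ` X = Y)"

definition equifacetal :: "'a::euclidean_space set \<Rightarrow> bool" where
  "equifacetal S \<longleftrightarrow>
     (\<forall>F F'. F facet_of S \<longrightarrow> F' facet_of S \<longrightarrow> congruent_sets F F')"

end

theory Submission imports Defs begin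

text \<open>
  An orthocentric simplex with vertex set \<open>V\<close> and orthocenter \<open>H\<close> is governed by one real number
  per vertex, the weight \<open>wt v = (v - H) \<bullet> (v - q)\<close>, which does not depend on the other vertex \<open>q\<close>.
  The vector \<open>v - H\<close> is orthogonal to every edge that avoids \<open>v\<close>, and so the squared length of an
  edge is \<open>wt i + wt j\<close>. Every condition of the theorem turns out to be equivalent to all weights
  being equal.

  With three vertices available, equal edges mean equal weights. Congruent facets have the same sum of
  squared edge lengths, and that sum is an affine function of the weight of the omitted vertex;
  conversely, for equal weights the reflection that swaps two vertices fixes all the others and hence
  carries one facet to another.

  A point is determined by its inner products with the edges. For \<open>H\<close> as origin, the inner product
  with the edge \<open>i - j\<close> is \<open>0\<close> for the orthocenter, \<open>(wt i - wt j) / (d + 1)\<close> for the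
  centroid in dimension \<open>d\<close> and \<open>(wt i - wt j) / 2\<close> for the circumcenter, which settles all
  coincidences among these three. The barycentric coordinates of the incenter are proportional to the norms of the gradients
  \<open>grad v\<close> of the barycentric coordinate functions, that is, to the reciprocals of the altitudes. So
  for the incenter the inner product is a multiple of
  \<open>norm (grad i) * wt i - norm (grad j) * wt j\<close>. The gradients and the weights are linked by the relation
  \<open>wt i * (norm (grad i))\<^sup>2 - wt j * (grad i \<bullet> grad j) = 1\<close> (lemma \<open>gradient_gram\<close>). Comparing
  it with the same relation for \<open>j\<close> handles the coincidence of the incenter with the centroid and with the
  orthocenter without any distinction between acute, right and obtuse simplices.

  If the incenter is the circumcenter, the weights are roots of one quadratic polynomial. Should two
  weights differ, they are its two roots, and Vieta's formulas, together with the fact that the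
  barycentric coordinates of the incenter are positive with sum \<open>1\<close>, lead to a contradiction.
\<close>

section \<open>Isometries and reflections\<close>

lemma isometry_affine:
  fixes f :: "'a::euclidean_space \<Rightarrow> 'a"
  assumes "\<forall>x y. dist (f x) (f y) = dist x y"
  obtains h where "linear h" "inj h" "\<And>S. f ` S = (+) (f 0) ` h ` S"
proof
  let ?h = "\<lambda>x. f x - f 0"
  show "linear ?h"
    using assms by (intro isometry_linear) (auto simp: dist_norm)
  show "inj ?h"
  proof (rule injI)
    fix x y assume "f x - f 0 = f y - f 0"
    then have "dist (f x) (f y) = 0" by simp
    then show "x = y" using assms by simp
  qed
  show "f ` S = (+) (f 0) ` ?h ` S" for S by (simp add: image_image)
qed

lemma isometry_vertices:
  fixes f :: "'a::euclidean_space \<Rightarrow> 'a"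
  assumes "\<forall>x y. dist (f x) (f y) = dist x y"
  shows "vertices (f ` S) = f ` vertices S"
proof -
  obtain h where h: "linear h" "inj h" and f: "\<And>S. f ` S = (+) (f 0) ` h ` S"
    using isometry_affine[OF assms] by metis
  have ext: "h x extreme_point_of h ` S \<longleftrightarrow> x extreme_point_of S" for x
    using face_of_linear_image[OF h, of "{x}" S] by (simp add: face_of_singleton)
  have "vertices (h ` S) \<subseteq> h ` S"
    unfolding vertices_def extreme_point_of_def by blast
  then have "vertices (h ` S) = h ` vertices S"
    unfolding vertices_def using ext by (auto simp: subset_iff)
  then show ?thesis
    unfolding f[of S] f[of "vertices S"] unfolding vertices_def
    using extreme_points_of_translation[of "f 0" "h ` S"] by simp
qed

lemma isometry_convex_hull:
  fixes f :: "'a::euclidean_space \<Rightarrow> 'a"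
  assumes "\<forall>x y. dist (f x) (f y) = dist x y"
  shows "f ` (convex hull X) = convex hull (f ` X)"
proof -
  obtain h where h: "linear h" and f: "\<And>S. f ` S = (+) (f 0) ` h ` S"
    using isometry_affine[OF assms] by metis
  show ?thesis
    unfolding f[of "convex hull X"] f[of X] convex_hull_linear_image[OF h] convex_hull_translation ..
qed

text \<open>
  The reflection in the bisecting hyperplane of \<open>i\<close> and \<open>j\<close>. The inner product in it is half the
  difference of the squared distances to \<open>j\<close> and \<open>i\<close>, from which all its values below are read off.
\<close>
lemma reflection_swap:
  fixes i j :: "'a::euclidean_space"
  assumes "i \<noteq> j"
  obtains f :: "'a \<Rightarrow> 'a" where "\<forall>x y. dist (f x) (f y) = dist x y" "f i = j" "f j = i"
    "\<And>x. dist x i = dist x j \<Longrightarrow> f x = x"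
proof
  let ?u = "i - j"
  let ?f = "\<lambda>x. x - (2 * (?u \<bullet> (x - midpoint i j)) / (?u \<bullet> ?u)) *\<^sub>R ?u"
  have u: "?u \<bullet> ?u \<noteq> 0" using assms by simp
  have mid: "?u \<bullet> (x - midpoint i j) = ((dist x j)\<^sup>2 - (dist x i)\<^sup>2) / 2" for x
    unfolding midpoint_def dist_norm power2_norm_eq_inner
    by (simp add: inner_diff_left inner_diff_right inner_add_right inner_commute field_simps)
  show "\<forall>x y. dist (?f x) (?f y) = dist x y"
  proof (intro allI)
    fix x y :: 'a
    define z where "z = x - y"
    define c where "c = 2 * (?u \<bullet> z) / (?u \<bullet> ?u)"
    have "?u \<bullet> z = ?u \<bullet> (x - midpoint i j) - ?u \<bullet> (y - midpoint i j)"
      by (simp add: z_def flip: inner_diff_right)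
    then have "c = 2 * (?u \<bullet> (x - midpoint i j)) / (?u \<bullet> ?u) - 2 * (?u \<bullet> (y - midpoint i j)) / (?u \<bullet> ?u)"
      unfolding c_def by (simp only: right_diff_distrib diff_divide_distrib)
    then have d: "?f x - ?f y = z - c *\<^sub>R ?u"
      unfolding z_def by (simp only: scaleR_left_diff_distrib) simp
    have c: "c * (?u \<bullet> ?u) = 2 * (?u \<bullet> z)" using u by (simp add: c_def)
    have "(norm (z - c *\<^sub>R ?u))\<^sup>2 = z \<bullet> z - 2 * c * (?u \<bullet> z) + c * (c * (?u \<bullet> ?u))"
      unfolding power2_norm_eq_inner
      by (simp only: inner_diff_left[of z] inner_diff_right[of _ z] inner_scaleR_left inner_scaleR_right
          inner_commute[of z ?u], algebra)
    also have "\<dots> = (norm z)\<^sup>2" unfolding c by (simp add: power2_norm_eq_inner)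
    finally show "dist (?f x) (?f y) = dist x y"
      unfolding dist_norm d by (simp add: z_def)
  qed
  have "2 * (?u \<bullet> (i - midpoint i j)) / (?u \<bullet> ?u) = 1"
    using u by (simp add: mid dist_norm flip: power2_norm_eq_inner)
  then show "?f i = j" by (simp only:) simp
  have "2 * (?u \<bullet> (j - midpoint i j)) / (?u \<bullet> ?u) = - 1"
    using u by (simp add: mid dist_norm norm_minus_commute flip: power2_norm_eq_inner)
  then show "?f j = i" by (simp only:) simp
  show "?f x = x" if "dist x i = dist x j" for x
    using that by (simp add: mid)
qed

section \<open>Barycentric coordinates of a full-dimensional simplex\<close>

locale full_simplex =
  fixes V :: "'a::euclidean_space set"
  assumes indep: "\<not> affine_dependent V"
    and card_V: "card V = DIM('a) + 1"
    and dim: "2 \<le> DIM('a)"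
begin

lemma finite_V: "finite V"
  using indep by (rule aff_independent_finite)

lemma other_vertex:
  obtains q where "q \<in> V" "q \<noteq> v" "q \<noteq> w"
proof -
  have "\<not> V \<subseteq> {v, w}"
  proof
    assume "V \<subseteq> {v, w}"
    then have "card V \<le> card {v, w}" by (intro card_mono) auto
    also have "\<dots> \<le> 2" by (simp add: card_insert_if)
    finally show False using card_V dim by simp
  qed
  then show ?thesis using that by blast
qed

text \<open>
  The barycentric coordinate of the vertex \<open>v\<close> is an affine function, and so its linear part is the
  inner product with a vector. The values of a linear map on the edges from one vertex can be
  prescribed since these edges are independent.
\<close>
lemma barycentric_gradient_exists:
  "\<exists>g. \<forall>p\<in>V. \<forall>q\<in>V. g \<bullet> (p - q) = of_bool (p = v) - of_bool (q = v)"
proof -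
  obtain o' where o: "o' \<in> V" "o' \<noteq> v" using other_vertex by blast
  let ?B = "(\<lambda>x. x - o') ` (V - {o'})"
  have "independent ?B"
    using indep affine_dependent_iff_dependent2[OF o(1)] by (simp add: image_def)
  then obtain f where f: "linear f" "\<And>b. b \<in> ?B \<Longrightarrow> f b = (of_bool (b = v - o') :: real)"
    using linear_independent_extend[of ?B "\<lambda>b. of_bool (b = v - o') :: real"] by blast
  let ?g = "adjoint f 1"
  have rep: "?g \<bullet> x = f x" for x
    using adjoint_works[OF f(1), of x 1] by (simp add: inner_commute)
  have val: "?g \<bullet> (p - o') = of_bool (p = v)" if "p \<in> V" for p
  proof (cases "p = o'")
    case True
    then show ?thesis using o by simp
  next
    case False
    then have "p - o' \<in> ?B" using that by blast
    then show ?thesis using f(2) by (simp add: rep)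
  qed
  have "?g \<bullet> (p - q) = of_bool (p = v) - of_bool (q = v)" if "p \<in> V" "q \<in> V" for p q
    using val[OF that(1)] val[OF that(2)] by (simp add: inner_diff_right)
  then show ?thesis by blast
qed

text \<open>
  The gradient of the barycentric coordinate function of \<open>v\<close>: it is normal to the facet opposite to
  \<open>v\<close>, and its norm is the reciprocal of the altitude.
\<close>
definition grad :: "'a \<Rightarrow> 'a" where
  "grad v = (SOME g. \<forall>p\<in>V. \<forall>q\<in>V. g \<bullet> (p - q) = of_bool (p = v) - of_bool (q = v))"

lemma grad: "p \<in> V \<Longrightarrow> q \<in> V \<Longrightarrow> grad v \<bullet> (p - q) = of_bool (p = v) - of_bool (q = v)"
  using someI_ex[OF barycentric_gradient_exists[of v]] unfolding grad_def by blast

lemma grad_nonzero: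
  assumes "v \<in> V" shows "grad v \<noteq> 0"
proof -
  obtain q where "q \<in> V" "q \<noteq> v" using other_vertex by blast
  then show ?thesis using grad[of v q v] assms by auto
qed

lemma grad_barycentric:
  assumes "sum u V = 1" "v \<in> V" "q \<in> V" "q \<noteq> v"
  shows "grad v \<bullet> ((\<Sum>p\<in>V. u p *\<^sub>R p) - q) = u v"
proof -
  have "(\<Sum>p\<in>V. u p *\<^sub>R p) - q = (\<Sum>p\<in>V. u p *\<^sub>R (p - q))"
    using assms(1) by (simp add: scaleR_right_diff_distrib sum_subtractf flip: scaleR_sum_left)
  then have "grad v \<bullet> ((\<Sum>p\<in>V. u p *\<^sub>R p) - q) = (\<Sum>p\<in>V. u p * (grad v \<bullet> (p - q)))"
    by (simp add: inner_sum_right)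
  also have "\<dots> = (\<Sum>p\<in>V. if p = v then u p else 0)"
    using assms grad by (intro sum.cong) auto
  also have "\<dots> = u v" using finite_V assms by simp
  finally show ?thesis .
qed

lemma barycentric_exists: "\<exists>u. sum u V = 1 \<and> (\<Sum>p\<in>V. u p *\<^sub>R p) = x"
proof -
  have "x \<in> affine hull V"
    using affine_independent_span_eq[OF indep] card_V by simp
  then show ?thesis using affine_hull_finite[OF finite_V] by auto
qed

text \<open>
  The coordinates of a vector are the changes of the barycentric coordinates from the origin to its
  end point, and these are inner products with the gradients.
\<close>
lemma vector_expansion:
  "(\<Sum>v\<in>V. grad v \<bullet> z) = 0" "(\<Sum>v\<in>V. (grad v \<bullet> z) *\<^sub>R v) = z"
proof -
  obtain u where u: "sum u V = 1" "(\<Sum>p\<in>V. u p *\<^sub>R p) = z" using barycentric_exists by blast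
  obtain t where t: "sum t V = 1" "(\<Sum>p\<in>V. t p *\<^sub>R p) = 0" using barycentric_exists by blast
  have *: "grad v \<bullet> z = u v - t v" if "v \<in> V" for v
  proof -
    obtain q where "q \<in> V" "q \<noteq> v" using other_vertex by blast
    then have "grad v \<bullet> (z - q) = u v" "grad v \<bullet> (0 - q) = t v"
      using grad_barycentric[OF u(1) that] grad_barycentric[OF t(1) that] u(2) t(2) by auto
    then show ?thesis by (simp add: inner_diff_right)
  qed
  show "(\<Sum>v\<in>V. grad v \<bullet> z) = 0" using * u t by (simp add: sum_subtractf)
  show "(\<Sum>v\<in>V. (grad v \<bullet> z) *\<^sub>R v) = z"
    using * u t by (simp add: sum_subtractf scaleR_left_diff_distrib)
qed

text \<open>
  The edges span the space: by \<open>vector_expansion\<close> the vector \<open>y - z\<close> is a combination of edges, and it is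
  orthogonal to them all, hence to itself.
\<close>
lemma eq_if_inner_edges_eq:
  assumes "\<And>p q. p \<in> V \<Longrightarrow> q \<in> V \<Longrightarrow> p \<noteq> q \<Longrightarrow> y \<bullet> (p - q) = z \<bullet> (p - q)"
  shows "y = z"
proof -
  obtain q where q: "q \<in> V" using other_vertex by blast
  let ?d = "y - z"
  have "?d = (\<Sum>v\<in>V. (grad v \<bullet> ?d) *\<^sub>R (v - q))"
    by (simp add: scaleR_right_diff_distrib sum_subtractf vector_expansion flip: scaleR_sum_left)
  then have "?d \<bullet> ?d = ?d \<bullet> (\<Sum>v\<in>V. (grad v \<bullet> ?d) *\<^sub>R (v - q))" by simp
  also have "\<dots> = (\<Sum>v\<in>V. (grad v \<bullet> ?d) * (?d \<bullet> (v - q)))" by (simp add: inner_sum_right)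
  also have "\<dots> = 0"
  proof (rule sum.neutral, rule ballI)
    fix v assume "v \<in> V"
    then show "(grad v \<bullet> ?d) * (?d \<bullet> (v - q)) = 0"
      using assms[of v q] q by (cases "v = q") (auto simp: inner_diff_left)
  qed
  finally show ?thesis by simp
qed

lemma vertices_hull: "vertices (convex hull V) = V"
  unfolding vertices_def using extreme_point_of_convex_hull_affine_independent[OF indep] by auto

lemma vertices_facet: "vertices (convex hull (V - {v})) = V - {v}"
  unfolding vertices_def
  using extreme_point_of_convex_hull_affine_independent affine_independent_Diff[OF indep] by auto

lemma facets:
  "F facet_of convex hull V \<longleftrightarrow> (\<exists>v\<in>V. F = convex hull (V - {v}))"
proof -
  have "convex hull (V - {v}) \<noteq> {}" for v
  proof -
    obtain q where "q \<in> V" "q \<noteq> v" using other_vertex by blast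
    then show ?thesis by auto
  qed
  then show ?thesis using facet_of_convex_hull_affine_independent[OF indep] by auto
qed

lemma grad_nonneg_on_hull:
  assumes "x \<in> convex hull V" "v \<in> V" "q \<in> V" "q \<noteq> v"
  shows "0 \<le> grad v \<bullet> (x - q)"
proof -
  obtain u where "\<And>p. p \<in> V \<Longrightarrow> 0 \<le> u p" "sum u V = 1" "(\<Sum>p\<in>V. u p *\<^sub>R p) = x"
    using assms(1) convex_hull_finite[OF finite_V] by auto
  then show ?thesis using grad_barycentric[of u v q] assms by auto
qed

lemma grad_zero_on_facet:
  assumes "x \<in> convex hull (V - {v})" "v \<in> V" "q \<in> V" "q \<noteq> v"
  shows "grad v \<bullet> (x - q) = 0"
proof -
  have "convex hull (V - {v}) \<subseteq> {x. grad v \<bullet> x = grad v \<bullet> q}"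
  proof (rule hull_minimal)
    show "V - {v} \<subseteq> {x. grad v \<bullet> x = grad v \<bullet> q}"
      using grad[of _ q v] assms by (fastforce simp: inner_diff_right)
  qed (rule convex_hyperplane)
  then show ?thesis using assms(1) by (auto simp: inner_diff_right)
qed

text \<open>
  A sphere inside the simplex has its point nearest to the facet opposite to \<open>v\<close> at a nonnegative
  coordinate, which bounds the coordinate of the center below by \<open>r * norm (grad v)\<close>; touching that
  facet bounds it above by the same number.
\<close>
lemma incenter_barycentric:
  assumes "is_incenter (convex hull V) I"
  obtains r where "r > 0" "(\<Sum>v\<in>V. r * norm (grad v)) = 1"
    "(\<Sum>v\<in>V. (r * norm (grad v)) *\<^sub>R v) = I"
proof -
  obtain r where r: "r > 0" "sphere I r \<subseteq> convex hull V"
    and touch: "\<And>F. F facet_of convex hull V \<Longrightarrow> sphere I r \<inter> F \<noteq> {}"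
    using assms unfolding is_incenter_def by blast
  obtain u where u: "sum u V = 1" "(\<Sum>p\<in>V. u p *\<^sub>R p) = I" using barycentric_exists by blast
  have eq: "u v = r * norm (grad v)" if v: "v \<in> V" for v
  proof -
    obtain q where q: "q \<in> V" "q \<noteq> v" using other_vertex by blast
    have I: "grad v \<bullet> (I - q) = u v" using grad_barycentric[OF u(1) v q] u(2) by simp
    \<comment> \<open>The point of the sphere where the coordinate of \<open>v\<close> is smallest.\<close>
    let ?y = "I - (r / norm (grad v)) *\<^sub>R grad v"
    have n: "norm (grad v) > 0" using grad_nonzero[OF v] by simp
    have "?y \<in> sphere I r" using n r by (simp add: dist_norm)
    then have "0 \<le> grad v \<bullet> (?y - q)" using r grad_nonneg_on_hull[OF _ v q] by blast
    also have "grad v \<bullet> (?y - q) = u v - r * norm (grad v)"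
      using I n by (simp add: inner_diff_right dot_square_norm power2_eq_square)
    finally have le: "r * norm (grad v) \<le> u v" by simp
    obtain y where y: "dist I y = r" "y \<in> convex hull (V - {v})"
      using touch[of "convex hull (V - {v})"] facets v by fastforce
    have "u v = grad v \<bullet> (I - y)"
      using grad_zero_on_facet[OF y(2) v q] I by (simp add: inner_diff_right)
    also have "\<dots> \<le> norm (grad v) * norm (I - y)" by (rule norm_cauchy_schwarz)
    also have "\<dots> = r * norm (grad v)" using y by (simp add: dist_norm)
    finally show ?thesis using le by simp
  qed
  show ?thesis
  proof
    show "r > 0" by fact
    show "(\<Sum>v\<in>V. r * norm (grad v)) = 1" using u(1) eq by simp
    show "(\<Sum>v\<in>V. (r * norm (grad v)) *\<^sub>R v) = I" using u(2) eq by simp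
  qed
qed

end

section \<open>Weights of an orthocentric simplex\<close>

locale orthocentric_simplex = full_simplex V for V :: "'a::euclidean_space set" +
  fixes H :: 'a
  assumes orth: "v \<in> V \<Longrightarrow> p \<in> V \<Longrightarrow> q \<in> V \<Longrightarrow> p \<noteq> v \<Longrightarrow> q \<noteq> v \<Longrightarrow> (v - H) \<bullet> (p - q) = 0"
begin

text \<open>
  Any choice of \<open>q\<close> gives the same value, because \<open>v - H\<close> is orthogonal to the facet opposite to \<open>v\<close>.
  Over \<open>H\<close> as origin the Gram matrix of the vertices is the diagonal matrix of the weights
  plus a constant matrix.
\<close>
definition wt :: "'a \<Rightarrow> real" where
  "wt v = (v - H) \<bullet> (v - (SOME q. q \<in> V \<and> q \<noteq> v))"

lemma wt: 
  assumes "v \<in> V" "q \<in> V" "q \<noteq> v" 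
  shows "(v - H) \<bullet> (v - q) = wt v"
proof -
  define p where "p = (SOME q. q \<in> V \<and> q \<noteq> v)"
  have "p \<in> V \<and> p \<noteq> v" unfolding p_def by (rule someI[of _ q]) (use assms in auto)
  then have "(v - H) \<bullet> (p - q) = 0" using orth assms by blast
  then show ?thesis unfolding wt_def p_def[symmetric] by (simp add: inner_diff_right)
qed

lemma inner_edge:
  assumes "i \<in> V" "j \<in> V" "i \<noteq> j"
  shows "(\<Sum>p\<in>V. u p *\<^sub>R (p - H)) \<bullet> (i - j) = u i * wt i - u j * wt j"
proof -
  have *: "(p - H) \<bullet> (i - j) = (if p = i then wt i else 0) - (if p = j then wt j else 0)"
    if "p \<in> V" for p
  proof -
    consider "p = i" | "p = j" | "p \<noteq> i" "p \<noteq> j" by blast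
    then show ?thesis
    proof cases
      case 1
      then show ?thesis using wt[of i j] assms by auto
    next
      case 2
      have "(j - H) \<bullet> (i - j) = - ((j - H) \<bullet> (j - i))" by (simp add: inner_diff_right)
      then show ?thesis using 2 wt[of j i] assms by auto
    next
      case 3
      then show ?thesis using orth that assms by auto
    qed
  qed
  have "(\<Sum>p\<in>V. u p *\<^sub>R (p - H)) \<bullet> (i - j) = (\<Sum>p\<in>V. u p * ((p - H) \<bullet> (i - j)))"
    by (simp add: inner_sum_left)
  also have "\<dots> = (\<Sum>p\<in>V. (if p = i then u i * wt i else 0) - (if p = j then u j * wt j else 0))"
    using * by (intro sum.cong) auto
  also have "\<dots> = u i * wt i - u j * wt j"
    using finite_V assms by (simp add: sum_subtractf)
  finally show ?thesis .
qed

lemma inner_edge_point: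
  assumes "i \<in> V" "j \<in> V" "i \<noteq> j" "sum u V = 1"
  shows "((\<Sum>p\<in>V. u p *\<^sub>R p) - H) \<bullet> (i - j) = u i * wt i - u j * wt j"
proof -
  have "(\<Sum>p\<in>V. u p *\<^sub>R (p - H)) = (\<Sum>p\<in>V. u p *\<^sub>R p) - H"
    using assms(4) by (simp add: scaleR_right_diff_distrib sum_subtractf flip: scaleR_sum_left)
  then show ?thesis using inner_edge[OF assms(1-3)] by metis
qed

lemma dist_vertices:
  assumes "i \<in> V" "j \<in> V" "i \<noteq> j"
  shows "(dist i j)\<^sup>2 = wt i + wt j"
proof -
  have "(dist i j)\<^sup>2 = (i - H) \<bullet> (i - j) + (j - H) \<bullet> (j - i)"
    by (simp add: dist_norm power2_norm_eq_inner inner_diff_left inner_diff_right inner_commute)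
  then show ?thesis using wt assms by auto
qed

text \<open>In particular at most one weight fails to be positive, which replaces a case analysis on the
  position of the orthocenter.\<close>
lemma wt_add_pos:
  assumes "i \<in> V" "j \<in> V" "i \<noteq> j"
  shows "wt i + wt j > 0"
  using dist_vertices[OF assms] assms(3) by (metis zero_less_dist_iff zero_less_power)

text \<open>
  The link between altitudes and weights: expand \<open>grad i\<close> in the vertices by \<open>vector_expansion\<close> and take
  the inner product with the edge \<open>i - j\<close>, along which the coordinate of \<open>i\<close> grows by \<open>1\<close>.
\<close>
lemma gradient_gram:
  assumes "i \<in> V" "j \<in> V" "i \<noteq> j"
  shows "wt i * (norm (grad i))\<^sup>2 - wt j * (grad i \<bullet> grad j) = 1"
proof -
  have "(\<Sum>v\<in>V. (grad v \<bullet> grad i) *\<^sub>R (v - H)) = grad i"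
    by (simp add: scaleR_right_diff_distrib sum_subtractf vector_expansion flip: scaleR_sum_left)
  then have "grad i \<bullet> (i - j) = (grad i \<bullet> grad i) * wt i - (grad j \<bullet> grad i) * wt j"
    using inner_edge[OF assms, of "\<lambda>v. grad v \<bullet> grad i"] by simp
  moreover have "grad i \<bullet> (i - j) = 1" using grad[of i j i] assms by auto
  ultimately show ?thesis by (simp add: power2_norm_eq_inner inner_commute mult.commute)
qed

definition equal_weights :: bool where
  "equal_weights \<longleftrightarrow> (\<forall>i\<in>V. \<forall>j\<in>V. wt i = wt j)"

lemma equal_weightsI:
  assumes "\<And>i j. i \<in> V \<Longrightarrow> j \<in> V \<Longrightarrow> i \<noteq> j \<Longrightarrow> wt i = wt j"
  shows equal_weights
  unfolding equal_weights_def
proof (intro ballI)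
  fix i j assume "i \<in> V" "j \<in> V"
  then show "wt i = wt j" using assms[of i j] by (cases "i = j") auto
qed

lemma equal_weightsD: "equal_weights \<Longrightarrow> i \<in> V \<Longrightarrow> j \<in> V \<Longrightarrow> wt i = wt j"
  unfolding equal_weights_def by blast

section \<open>Regular and equifacetal simplices\<close>

lemma regular_iff: "regular_simplex (convex hull V) \<longleftrightarrow> equal_weights"
proof
  assume "regular_simplex (convex hull V)"
  then obtain l where "\<forall>v\<in>V. \<forall>w\<in>V. v \<noteq> w \<longrightarrow> dist v w = l"
    unfolding regular_simplex_def vertices_hull ..
  then have l: "dist v w = l" if "v \<in> V" "w \<in> V" "v \<noteq> w" for v w using that by auto
  show equal_weights
  proof (rule equal_weightsI)
    fix i j assume ij: "i \<in> V" "j \<in> V" "i \<noteq> j"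
    obtain k where k: "k \<in> V" "k \<noteq> i" "k \<noteq> j" using other_vertex by blast
    have "(dist i k)\<^sup>2 = (dist j k)\<^sup>2" using l[of i k] l[of j k] ij k by simp
    then show "wt i = wt j" using dist_vertices ij k by auto
  qed
next
  assume e: equal_weights
  obtain o' where o: "o' \<in> V" using other_vertex by blast
  have "dist v w = sqrt (2 * wt o')" if "v \<in> V" "w \<in> V" "v \<noteq> w" for v w
  proof -
    have "(dist v w)\<^sup>2 = 2 * wt o'"
      using dist_vertices[OF that] equal_weightsD[OF e that(1) o] equal_weightsD[OF e that(2) o] by linarith
    then show ?thesis by (simp add: real_sqrt_unique)
  qed
  then show "regular_simplex (convex hull V)"
    unfolding regular_simplex_def vertices_hull by (intro exI[of _ "sqrt (2 * wt o')"]) auto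
qed

text \<open>
  An invariant of the facet opposite to \<open>v\<close> under congruence that depends on \<open>v\<close> through \<open>wt v\<close> alone.
\<close>
lemma facet_square_sum:
  assumes "v \<in> V"
  shows "(\<Sum>p\<in>V-{v}. \<Sum>q\<in>V-{v}. (dist p q)\<^sup>2) = 2 * (real DIM('a) - 1) * (sum wt V - wt v)"
proof -
  let ?W = "V - {v}"
  have W: "finite ?W" "card ?W = DIM('a)" using finite_V card_V assms by auto
  have "(\<Sum>q\<in>?W. (dist p q)\<^sup>2) = (\<Sum>q\<in>?W. wt p + wt q - (if q = p then 2 * wt p else 0))"
    if "p \<in> ?W" for p
    using that dist_vertices by (intro sum.cong) auto
  also have "\<dots>p = real DIM('a) * wt p + sum wt ?W - 2 * wt p" if "p \<in> ?W" for p
    using that W by (simp add: sum_subtractf sum.distrib)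
  finally have "(\<Sum>p\<in>?W. \<Sum>q\<in>?W. (dist p q)\<^sup>2)
      = (\<Sum>p\<in>?W. real DIM('a) * wt p + sum wt ?W - 2 * wt p)"
    by (intro sum.cong) auto
  also have "\<dots> = 2 * (real DIM('a) - 1) * sum wt ?W"
    using W by (simp add: sum_subtractf sum.distrib algebra_simps flip: sum_distrib_left)
  also have "sum wt ?W = sum wt V - wt v" using finite_V assms by (simp add: sum_diff1)
  finally show ?thesis .
qed

lemma equifacetal_iff: "equifacetal (convex hull V) \<longleftrightarrow> equal_weights"
proof
  assume e: "equifacetal (convex hull V)"
  show equal_weights
  proof (rule equal_weightsI)
    fix i j assume ij: "i \<in> V" "j \<in> V"
    then have "congruent_sets (convex hull (V - {i})) (convex hull (V - {j}))"
      using e facets unfolding equifacetal_def by blast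
    then obtain f :: "'a \<Rightarrow> 'a" where f: "\<forall>x y. dist (f x) (f y) = dist x y"
      and im: "f ` (convex hull (V - {i})) = convex hull (V - {j})"
      unfolding congruent_sets_def by blast
    have "f ` (V - {i}) = V - {j}"
      using isometry_vertices[OF f, of "convex hull (V - {i})"] by (simp add: im vertices_facet)
    moreover have inj: "inj_on f A" for A
      by (rule inj_onI) (metis f dist_eq_0_iff)
    ultimately have "(\<Sum>p\<in>V-{j}. \<Sum>q\<in>V-{j}. (dist p q)\<^sup>2)
        = (\<Sum>p\<in>V-{i}. \<Sum>q\<in>V-{i}. (dist (f p) (f q))\<^sup>2)"
      by (metis (no_types, lifting) sum.reindex_cong)
    then have "(real DIM('a) - 1) * (sum wt V - wt j) = (real DIM('a) - 1) * (sum wt V - wt i)"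
      using f facet_square_sum ij by simp
    then show "wt i = wt j" using dim by simp
  qed
next
  assume e: equal_weights
  have "congruent_sets (convex hull (V - {i})) (convex hull (V - {j}))"
    if ij: "i \<in> V" "j \<in> V" for i j
  proof (cases "i = j")
    case True
    then show ?thesis unfolding congruent_sets_def by (intro exI[of _ id]) auto
  next
    case False
    obtain f :: "'a \<Rightarrow> 'a" where f: "\<forall>x y. dist (f x) (f y) = dist x y"
      and sw: "f i = j" "f j = i" and fixes_eq: "\<And>x. dist x i = dist x j \<Longrightarrow> f x = x"
      using reflection_swap[OF False] by blast
    have fixed: "f k = k" if "k \<in> V" "k \<noteq> i" "k \<noteq> j" for k
    proof (rule fixes_eq)
      have "(dist k i)\<^sup>2 = (dist k j)\<^sup>2"
        using dist_vertices[of k i] dist_vertices[of k j] equal_weightsD[OF e ij] that ij by simp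
      then show "dist k i = dist k j" by simp
    qed
    have "V - {i} = insert j (V - {i, j})" "V - {j} = insert i (V - {i, j})"
      using ij False by auto
    moreover have "f ` (V - {i, j}) = V - {i, j}" using fixed by force
    ultimately have "f ` (V - {i}) = V - {j}" using sw by simp
    then have "f ` (convex hull (V - {i})) = convex hull (V - {j})"
      using isometry_convex_hull[OF f] by metis
    then show ?thesis unfolding congruent_sets_def using f by blast
  qed
  then show "equifacetal (convex hull V)"
    unfolding equifacetal_def facets by blast
qed

section \<open>The four centers\<close>

lemma centroid_inner:
  assumes "is_centroid (convex hull V) G" "i \<in> V" "j \<in> V" "i \<noteq> j"
  shows "(G - H) \<bullet> (i - j) = (wt i - wt j) / (real DIM('a) + 1)"
proof -
  let ?u = "\<lambda>_::'a. 1 / (real DIM('a) + 1)"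
  have "sum ?u V = 1" using card_V by simp
  moreover have "G = (\<Sum>p\<in>V. ?u p *\<^sub>R p)"
    using assms(1) card_V unfolding is_centroid_def vertices_hull by (simp add: scaleR_sum_right add.commute)
  ultimately show ?thesis
    using inner_edge_point[of i j ?u] assms by (simp add: diff_divide_distrib)
qed

lemma circumcenter_inner:
  assumes "is_circumcenter (convex hull V) C" "i \<in> V" "j \<in> V" "i \<noteq> j"
  shows "(C - H) \<bullet> (i - j) = (wt i - wt j) / 2"
proof -
  obtain \<rho> where "V \<subseteq> sphere C \<rho>"
    using assms(1) unfolding is_circumcenter_def vertices_hull by blast
  then have "dist C i = dist C j"
    using assms(2,3) by (metis mem_sphere subsetD)
  then have "(C - i) \<bullet> (C - i) = (C - j) \<bullet> (C - j)"
    by (simp add: dist_norm flip: power2_norm_eq_inner)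
  then have "2 * ((C - H) \<bullet> (i - j)) = (i - H) \<bullet> (i - j) - (j - H) \<bullet> (j - i)"
    by (simp add: inner_diff_left inner_diff_right inner_commute)
  then show ?thesis using wt assms by auto
qed

lemma incenter_inner:
  assumes "is_incenter (convex hull V) I"
  obtains r where "r > 0" "(\<Sum>v\<in>V. r * norm (grad v)) = 1"
    "\<forall>i\<in>V. \<forall>j\<in>V. i \<noteq> j \<longrightarrow>
      (I - H) \<bullet> (i - j) = r * norm (grad i) * wt i - r * norm (grad j) * wt j"
proof -
  obtain r where r: "r > 0" "(\<Sum>v\<in>V. r * norm (grad v)) = 1"
    "(\<Sum>v\<in>V. (r * norm (grad v)) *\<^sub>R v) = I"
    using incenter_barycentric[OF assms] .
  show ?thesis
    using that[OF r(1,2)] inner_edge_point[OF _ _ _ r(2)] r(3) by simp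
qed

lemma centers_coincide:
  assumes e: equal_weights
    and G: "is_centroid (convex hull V) G" and C: "is_circumcenter (convex hull V) C"
    and I: "is_incenter (convex hull V) I"
  shows "G = H" "C = H" "I = H"
proof -
  have "(G - H) \<bullet> (i - j) = 0" if "i \<in> V" "j \<in> V" "i \<noteq> j" for i j
    using centroid_inner[OF G that] equal_weightsD[OF e that(1,2)] by simp
  then show "G = H"
    by (intro eq_if_inner_edges_eq) (simp add: inner_diff_left)
  have "(C - H) \<bullet> (i - j) = 0" if "i \<in> V" "j \<in> V" "i \<noteq> j" for i j
    using circumcenter_inner[OF C that] equal_weightsD[OF e that(1,2)] by simp
  then show "C = H"
    by (intro eq_if_inner_edges_eq) (simp add: inner_diff_left)
  obtain r where "r > 0" "(\<Sum>v\<in>V. r * norm (grad v)) = 1"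
    and I: "\<forall>i\<in>V. \<forall>j\<in>V. i \<noteq> j \<longrightarrow>
      (I - H) \<bullet> (i - j) = r * norm (grad i) * wt i - r * norm (grad j) * wt j"
    using incenter_inner[OF I] .
  have *: "(I - H) \<bullet> (i - j) = 0" if ij: "i \<in> V" "j \<in> V" "i \<noteq> j" for i j
  proof -
    have w: "wt i = wt j" "wt j > 0" using equal_weightsD[OF e ij(1,2)] wt_add_pos[OF ij] by auto
    have "wt j * ((norm (grad i))\<^sup>2 - (norm (grad j))\<^sup>2) = 0"
      using gradient_gram[OF ij] gradient_gram[OF ij(2,1) ij(3)[symmetric]] w(1)
        inner_commute[of "grad i" "grad j"] by algebra
    then have "norm (grad i) = norm (grad j)" using w by simp
    then show ?thesis using I ij w by simp
  qed
  show "I = H"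
    using * by (intro eq_if_inner_edges_eq) (simp add: inner_diff_left)
qed

section \<open>Coincidences of two centers\<close>

lemma equal_weights_if_centroid_eq_circumcenter:
  assumes "is_centroid (convex hull V) X" "is_circumcenter (convex hull V) X"
  shows equal_weights
proof (rule equal_weightsI)
  fix i j assume ij: "i \<in> V" "j \<in> V" "i \<noteq> j"
  have "(wt i - wt j) / (real DIM('a) + 1) = (wt i - wt j) / 2"
    using centroid_inner[OF assms(1) ij] circumcenter_inner[OF assms(2) ij] by (rule trans[OF sym])
  then have "(real DIM('a) - 1) * (wt i - wt j) = 0" by (simp add: field_simps)
  then show "wt i = wt j" using dim by simp
qed

lemma equal_weights_if_centroid_eq_orthocenter:
  assumes "is_centroid (convex hull V) H"
  shows equal_weights
proof (rule equal_weightsI)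
  fix i j assume "i \<in> V" "j \<in> V" "i \<noteq> j"
  from centroid_inner[OF assms this] show "wt i = wt j" by simp
qed

lemma equal_weights_if_circumcenter_eq_orthocenter:
  assumes "is_circumcenter (convex hull V) H"
  shows equal_weights
proof (rule equal_weightsI)
  fix i j assume "i \<in> V" "j \<in> V" "i \<noteq> j"
  from circumcenter_inner[OF assms this] show "wt i = wt j" by simp
qed

text \<open>
  All gradients have the same norm. Then the two instances of \<open>gradient_gram\<close> for \<open>i\<close> and \<open>j\<close> force equal
  weights unless \<open>grad i = - grad j\<close>, and a third vertex excludes opposite gradients.
\<close>
lemma equal_weights_if_centroid_eq_incenter:
  assumes G: "is_centroid (convex hull V) X" and I: "is_incenter (convex hull V) X"
  shows equal_weights
proof (rule equal_weightsI)
  fix i j assume ij: "i \<in> V" "j \<in> V" "i \<noteq> j"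
  obtain r where r: "r > 0" "(\<Sum>v\<in>V. r * norm (grad v)) = 1"
    "(\<Sum>v\<in>V. (r * norm (grad v)) *\<^sub>R v) = X"
    using incenter_barycentric[OF I] .
  let ?u = "\<lambda>_::'a. 1 / (real DIM('a) + 1)"
  have u: "sum ?u V = 1" "(\<Sum>p\<in>V. ?u p *\<^sub>R p) = X"
    using G card_V unfolding is_centroid_def vertices_hull
    by (simp_all add: scaleR_sum_right add.commute)
  have "r * norm (grad v) = 1 / (real DIM('a) + 1)" if "v \<in> V" for v
  proof -
    obtain q where q: "q \<in> V" "q \<noteq> v" using other_vertex by blast
    show ?thesis
      using grad_barycentric[OF r(2) that q] grad_barycentric[OF u(1) that q] r(3) u(2) by simp
  qed
  then have "r * norm (grad i) = r * norm (grad j)" using ij by simp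
  then have n: "norm (grad i) = norm (grad j)" using r(1) by simp
  have "(wt i - wt j) * ((norm (grad i))\<^sup>2 + grad i \<bullet> grad j) = 0"
    using gradient_gram[OF ij] gradient_gram[OF ij(2,1) ij(3)[symmetric]] n inner_commute[of "grad i" "grad j"]
    by algebra
  moreover have "(norm (grad i))\<^sup>2 + grad i \<bullet> grad j \<noteq> 0"
  proof
    assume "(norm (grad i))\<^sup>2 + grad i \<bullet> grad j = 0"
    moreover have "(norm (grad i + grad j))\<^sup>2
        = (norm (grad i))\<^sup>2 + 2 * (grad i \<bullet> grad j) + (norm (grad j))\<^sup>2"
      by (simp add: power2_norm_eq_inner inner_add_left inner_add_right inner_commute)
    ultimately have "(norm (grad i + grad j))\<^sup>2 = 0" using n by simp
    then have z: "grad i + grad j = 0" by simp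
    obtain k where k: "k \<in> V" "k \<noteq> i" "k \<noteq> j" using other_vertex by blast
    have "(grad i + grad j) \<bullet> (i - k) = 1"
      using grad[OF ij(1) k(1), of i] grad[OF ij(1) k(1), of j] k ij(3) by (simp add: inner_add_left)
    then show False using z by simp
  qed
  ultimately show "wt i = wt j" by simp
qed

text \<open>
  Here \<open>norm (grad i) * wt i\<close> is the same for all vertices. Multiplying \<open>gradient_gram\<close> by \<open>wt i\<close> makes both
  terms on the left symmetric in \<open>i\<close> and \<open>j\<close>, while the right-hand side is \<open>wt i\<close>.
\<close>
lemma equal_weights_if_incenter_eq_orthocenter:
  assumes "is_incenter (convex hull V) H"
  shows equal_weights
proof (rule equal_weightsI)
  fix i j assume ij: "i \<in> V" "j \<in> V" "i \<noteq> j"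
  obtain r where r: "r > 0" and I: "\<forall>i\<in>V. \<forall>j\<in>V. i \<noteq> j \<longrightarrow>
      (H - H) \<bullet> (i - j) = r * norm (grad i) * wt i - r * norm (grad j) * wt j"
    using incenter_inner[OF assms] .
  have "r * (norm (grad i) * wt i) = r * (norm (grad j) * wt j)" using I ij by simp
  then have "norm (grad i) * wt i = norm (grad j) * wt j" using r by simp
  then have "wt i * (wt i * (norm (grad i))\<^sup>2) = wt j * (wt j * (norm (grad j))\<^sup>2)"
    by algebra
  moreover have "wt i * (wt i * (norm (grad i))\<^sup>2 - wt j * (grad i \<bullet> grad j)) = wt i"
    "wt j * (wt j * (norm (grad j))\<^sup>2 - wt i * (grad i \<bullet> grad j)) = wt j"
    using gradient_gram[OF ij] gradient_gram[OF ij(2,1)] ij(3) by (simp_all add: inner_commute)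
  ultimately show "wt i = wt j" by algebra
qed

text \<open>
  The off-diagonal inner products are eliminated from \<open>gradient_gram\<close> by the fact that the gradients
  have sum zero, as the barycentric coordinates have sum \<open>1\<close>.
\<close>
lemma gram_diagonal:
  assumes nz: "\<And>v. v \<in> V \<Longrightarrow> wt v \<noteq> 0" and i: "i \<in> V"
  shows "wt i * (wt i * (norm (grad i))\<^sup>2 - 1) * (\<Sum>v\<in>V. 1 / wt v) = - 1"
proof -
  let ?t = "wt i * (norm (grad i))\<^sup>2 - 1"
  have off: "grad j \<bullet> grad i = ?t * (1 / wt j)" if "j \<in> V - {i}" for j
    using gradient_gram[of i j] nz[of j] i that by (auto simp: field_simps inner_commute)
  have "0 = (\<Sum>v\<in>V. grad v \<bullet> grad i)" by (simp add: vector_expansion)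
  also have "\<dots> = (norm (grad i))\<^sup>2 + (\<Sum>v\<in>V-{i}. grad v \<bullet> grad i)"
    using finite_V i by (simp add: sum.remove power2_norm_eq_inner)
  also have "(\<Sum>v\<in>V-{i}. grad v \<bullet> grad i) = ?t * (\<Sum>v\<in>V-{i}. 1 / wt v)"
    unfolding sum_distrib_left using off by (intro sum.cong) auto
  also have "(\<Sum>v\<in>V-{i}. 1 / wt v) = (\<Sum>v\<in>V. 1 / wt v) - 1 / wt i"
    using finite_V i by (simp add: sum_diff1)
  finally show ?thesis using nz[OF i] by (simp add: field_simps power2_eq_square)
qed

text \<open>
  Let \<open>w v\<close> be the barycentric coordinates of the common center. The incenter and circumcenter conditions
  make \<open>(1 - 2 * w v) * wt v\<close> a constant \<open>k\<close>, and then \<open>gram_diagonal\<close> turns into a quadratic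
  equation for \<open>wt v\<close> whose coefficients do not depend on \<open>v\<close>. Two different roots would exceed \<open>k\<close>,
  while Vieta's formulas give \<open>(wt i - k) * (wt j - k)\<close> the sign of \<open>1 - k * s\<close>, and
  \<open>k * s = d - 1\<close>.
\<close>
lemma equal_weights_if_circumcenter_eq_incenter:
  assumes C: "is_circumcenter (convex hull V) X" and I: "is_incenter (convex hull V) X"
  shows equal_weights
proof (rule equal_weightsI)
  fix i j assume ij: "i \<in> V" "j \<in> V" "i \<noteq> j"
  obtain r where r: "r > 0" and sum_r: "(\<Sum>v\<in>V. r * norm (grad v)) = 1"
    and inner_I: "\<forall>i\<in>V. \<forall>j\<in>V. i \<noteq> j \<longrightarrow>
      (X - H) \<bullet> (i - j) = r * norm (grad i) * wt i - r * norm (grad j) * wt j"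
    using incenter_inner[OF I] .
  define w where "w v = r * norm (grad v)" for v
  have w_pos: "w v > 0" if "v \<in> V" for v using grad_nonzero[OF that] r by (simp add: w_def)
  have sum_w: "sum w V = 1" using sum_r by (simp add: w_def[abs_def])
  define k where "k = (1 - 2 * w i) * wt i"
  have k: "(1 - 2 * w v) * wt v = k" if "v \<in> V" for v
  proof (cases "v = i")
    case False
    then have "w v * wt v - w i * wt i = (wt v - wt i) / 2"
      using inner_I that ij(1) circumcenter_inner[OF C that ij(1)] by (simp add: w_def)
    then show ?thesis unfolding k_def by (simp add: algebra_simps)
  qed (simp add: k_def)
  have k_pos: "k > 0"
  proof (rule ccontr)
    assume k0: "\<not> k > 0"
    have neg: "wt v \<le> 0" if "v \<in> V" "w v < 1 / 2" for v
    proof (rule ccontr)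
      assume "\<not> wt v \<le> 0"
      then have "(1 - 2 * w v) * wt v > 0" using that(2) by simp
      then show False using k[OF that(1)] k0 by simp
    qed
    \<comment> \<open>Among three positive coordinates with sum at most \<open>1\<close>, two are below \<open>1 / 2\<close>, and their
      vertices would both have a weight that is not positive.\<close>
    obtain l where l: "l \<in> V" "l \<noteq> i" "l \<noteq> j" using other_vertex by blast
    have "sum w {i, j, l} \<le> sum w V"
      using finite_V ij l w_pos by (intro sum_mono2) (auto intro: less_imp_le)
    then have "w i + w j + w l \<le> 1" using sum_w ij l by auto
    then consider "w i < 1/2" "w j < 1/2" | "w i < 1/2" "w l < 1/2" | "w j < 1/2" "w l < 1/2"
      using w_pos[OF ij(1)] w_pos[OF ij(2)] w_pos[OF l(1)] by linarith
    then show False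
      using neg[OF ij(1)] neg[OF ij(2)] neg[OF l(1)] wt_add_pos[OF ij]
        wt_add_pos[OF ij(1) l(1) l(2)[symmetric]] wt_add_pos[OF ij(2) l(1) l(3)[symmetric]]
      by cases linarith+
  qed
  have nz: "wt v \<noteq> 0" if "v \<in> V" for v using k[OF that] k_pos by auto
  define s where "s = (\<Sum>v\<in>V. 1 / wt v)"
  have ks: "k * s = real DIM('a) - 1"
  proof -
    have "k * s = (\<Sum>v\<in>V. 1 - 2 * w v)"
      unfolding s_def sum_distrib_left using k nz by (intro sum.cong) (auto simp: field_simps)
    also have "\<dots> = real DIM('a) - 1"
      using card_V sum_w by (simp add: sum_subtractf flip: sum_distrib_left)
    finally show ?thesis .
  qed
  define b where "b = 4 * r\<^sup>2"
  have b: "b > 0" using r by (simp add: b_def)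
  have quad: "((wt v - k)\<^sup>2 - b * wt v) * s = - b" if "v \<in> V" for v
  proof -
    have "wt v - k = 2 * r * norm (grad v) * wt v"
      using k[OF that] by (simp add: w_def algebra_simps)
    then have "((wt v - k)\<^sup>2 - b * wt v) * s
        = b * (wt v * (wt v * (norm (grad v))\<^sup>2 - 1) * s)"
      unfolding b_def by algebra
    then show ?thesis using gram_diagonal[OF nz that] by (simp add: s_def)
  qed
  have "k * s > 0" unfolding ks using dim by simp
  then have s: "s > 0" using k_pos by (rule zero_less_mult_pos)
  show "wt i = wt j"
  proof (rule ccontr)
    assume ne: "wt i \<noteq> wt j"
    have "(wt i - wt j) * (wt i + wt j - 2 * k - b) * s = 0"
      using quad[OF ij(1)] quad[OF ij(2)] by algebra
    then have vieta_sum: "wt i + wt j = 2 * k + b" using ne s by simp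
    have vieta_prod: "(wt i * wt j - k\<^sup>2) * s = b"
      using quad[OF ij(1)] vieta_sum by algebra
    then have "wt i * wt j - k\<^sup>2 > 0" using b s by (metis zero_less_mult_pos2)
    then have "wt i * wt j > 0" by (smt (verit) zero_le_power2)
    then have pos: "wt i > 0" "wt j > 0"
      using wt_add_pos[OF ij] by (auto simp: zero_less_mult_iff)
    have "wt v > k" if "v \<in> V" "wt v > 0" for v
    proof -
      have "wt v - k = 2 * w v * wt v" using k[OF that(1)] by (simp add: algebra_simps)
      moreover have "2 * w v * wt v > 0" using w_pos[OF that(1)] that(2) by simp
      ultimately show ?thesis by linarith
    qed
    then have "(wt i - k) * (wt j - k) * s > 0" using pos ij s by simp
    also have "(wt i - k) * (wt j - k) * s
        = (wt i * wt j - k\<^sup>2) * s - k * s * (wt i + wt j - 2 * k)"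
      by (simp add: algebra_simps power2_eq_square)
    also have "\<dots> = b * (1 - k * s)"
      unfolding vieta_prod vieta_sum by (simp add: algebra_simps)
    finally have "k * s < 1" using b by (simp add: zero_less_mult_iff)
    then show False using ks dim by simp
  qed
qed

end

theorem mainTheorem1:
  fixes S :: "'a::euclidean_space set" and G C I H :: 'a
  assumes "DIM('a) \<ge> 3"
    and "int DIM('a) simplex S"
    and "orthocentric S"
    and "is_centroid S G"
    and "is_circumcenter S C"
    and "is_incenter S I"
    and "is_orthocenter S H"
  shows "(regular_simplex S \<longleftrightarrow> equifacetal S) \<and>
         (equifacetal S \<longleftrightarrow> G = C \<and> C = I \<and> I = H) \<and>
         (G = C \<and> C = I \<and> I = H \<longleftrightarrow>
            G = C \<or> G = I \<or> G = H \<or> C = I \<or> C = H \<or> I = H)"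
proof -
  obtain V where V: "\<not> affine_dependent V" "int (card V) = int DIM('a) + 1" "S = convex hull V"
    using assms(2) unfolding simplex_def by blast
  interpret full_simplex V
    using V(1,2) assms(1) by unfold_locales auto
  interpret orthocentric_simplex V H
  proof
    fix v p q assume v: "v \<in> V" and p: "p \<in> V" "p \<noteq> v" and q: "q \<in> V" "q \<noteq> v"
    have "p \<in> affine hull (opposite_facet S v)" "q \<in> affine hull (opposite_facet S v)"
      unfolding opposite_facet_def V(3) vertices_hull using p q by (auto intro: hull_inc)
    moreover have "H \<in> altitude S v"
      using assms(7) v unfolding is_orthocenter_def V(3) vertices_hull by blast
    ultimately have "(H - v) \<bullet> (p - q) = 0"
      unfolding altitude_def orthogonal_def by blast
    then show "(v - H) \<bullet> (p - q) = 0" by (simp add: inner_diff_left)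
  qed
  note centers = assms(4-6)[unfolded V(3)]
  have "equal_weights" if "G = C \<or> G = I \<or> G = H \<or> C = I \<or> C = H \<or> I = H"
    using that centers equal_weights_if_centroid_eq_circumcenter equal_weights_if_centroid_eq_incenter equal_weights_if_centroid_eq_orthocenter
      equal_weights_if_circumcenter_eq_incenter equal_weights_if_circumcenter_eq_orthocenter equal_weights_if_incenter_eq_orthocenter by metis
  moreover have "G = C \<and> C = I \<and> I = H" if equal_weights
    using centers_coincide[OF that centers] by simp
  ultimately show ?thesis
    using regular_iff equifacetal_iff V(3) by blast
qed

end
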